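(* Let $b>0$ be a public budget and let $V=\times_{j=1}^m V_j$ be a valuation distribution of an additive buyer over $m$ items that is independent across items. Then $$\mathrm{Rev}^b(V)\le 5\,\mathrm{SRev}^b(V)+6\,\mathrm{BRev}^b(V).$$
   Context: A seller sells $m$ heterogeneous indivisible items (one copy each) to one buyer. The buyer's type is a vector $v\in\mathbb{R}_{\ge 0}^m$ of item values; his value for a set $S$ of items is $\sum_{j\in S}v_j$. The type is drawn from a discrete (finitely supported) distribution $V$, with support $T$ and probability mass function $f$; $V$ is independent across items if it is a product $\times_j V_j$. The seller knows $V$ and the budget $b$ but not $v$. Write $\|v\|_1=\sum_j |v_j|$. A mechanism is a pair $\pi:T\to[0,1]^m$, $p:T\to\mathbb{R}$, extended by $\pi(\varnothing)=0$, $p(\varnothing)=0$. It is truthful (interim IC and IR) if $\pi(t)^\top t-p(t)\ge \pi(t')^\top t-p(t')$ for all $t\in T$, $t'\in T\cup\{\varnothing\}$. $\mathrm{Rev}^b(V)$ is the maximum of $\sum_{t\in T}f(t)p(t)$ over truthful mechanisms that also satisfy $p(t)\le b$ for all $t\in T$. $\mathrm{SRev}^b(V)$ is the maximum expected revenue obtainable by posting item prices $p_1,\dots,p_m\ge0$, where a buyer of type $v$ buys a set $S$ maximizing $\sum_{j\in S}(v_j-p_j)$ subject to $\sum_{j\in S}p_j\le b$ (ties broken in favor of the seller). $\mathrm{BRev}^b(V)=\max_{0\le p\le b}\, p\cdot\Pr_{v\sim V}[\|v\|_1\ge p]$ is the maximum revenue from pricing the grand bundle. *)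

theory Defs
  imports "HOL-Probability.Probability"
begin

text \<open>
  Items are the elements of a finite type \<open>'m\<close>; a type (valuation vector) of the buyer is a
  function \<open>'m \<Rightarrow> real\<close>, and a valuation distribution is a probability mass function on such
  functions, with \<open>set_pmf V\<close> as its support \<open>T\<close> and \<open>pmf V\<close> as \<open>f\<close>.
\<close>

definition norm1 :: "('m::finite \<Rightarrow> real) \<Rightarrow> real" where
  "norm1 v = (\<Sum>j\<in>UNIV. \<bar>v j\<bar>)"

type_synonym 'm alloc = "('m \<Rightarrow> real) \<Rightarrow> 'm \<Rightarrow> real"
type_synonym 'm payment = "('m \<Rightarrow> real) \<Rightarrow> real"

definition utility :: "'m::finite alloc \<Rightarrow> 'm payment \<Rightarrow> ('m \<Rightarrow> real) \<Rightarrow> ('m \<Rightarrow> real) \<Rightarrow> real" where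
  "utility q p t t' = (\<Sum>j\<in>UNIV. q t' j * t j) - p t'"

text \<open>
  Only the values of \<open>q\<close> and \<open>p\<close> on \<open>T\<close> matter. In \<open>truthful\<close> the second conjunct is the
  deviation to the report \<open>\<emptyset>\<close>, whose allocation and payment are zero. Payments may be negative.
\<close>

definition mechanism :: "('m::finite \<Rightarrow> real) set \<Rightarrow> 'm alloc \<Rightarrow> bool" where
  "mechanism T q \<longleftrightarrow> (\<forall>t\<in>T. \<forall>j. 0 \<le> q t j \<and> q t j \<le> 1)"

definition truthful :: "('m::finite \<Rightarrow> real) set \<Rightarrow> 'm alloc \<Rightarrow> 'm payment \<Rightarrow> bool" where
  "truthful T q p \<longleftrightarrow>
     (\<forall>t\<in>T. \<forall>t'\<in>T. utility q p t t \<ge> utility q p t t') \<and>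
     (\<forall>t\<in>T. utility q p t t \<ge> 0)"

definition exp_payment :: "('m::finite \<Rightarrow> real) pmf \<Rightarrow> 'm payment \<Rightarrow> real" where
  "exp_payment V p = (\<Sum>t\<in>set_pmf V. pmf V t * p t)"

text \<open>
  The maxima over mechanisms and prices are written as suprema; the lemmas at the end show that,
  for \<open>b > 0\<close> and finitely supported \<open>V\<close>, they range over nonempty sets bounded above by \<open>b\<close>.
\<close>

definition rev_set :: "real \<Rightarrow> ('m::finite \<Rightarrow> real) pmf \<Rightarrow> real set" where
  "rev_set b V = {exp_payment V p | q p.
     mechanism (set_pmf V) q \<and> truthful (set_pmf V) q p \<and> (\<forall>t\<in>set_pmf V. p t \<le> b)}"

definition Rev :: "real \<Rightarrow> ('m::finite \<Rightarrow> real) pmf \<Rightarrow> real" where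
  "Rev b V = Sup (rev_set b V)"

definition affordable :: "real \<Rightarrow> ('m::finite \<Rightarrow> real) \<Rightarrow> 'm set set" where
  "affordable b p = {S. (\<Sum>j\<in>S. p j) \<le> b}"

definition demand :: "real \<Rightarrow> ('m::finite \<Rightarrow> real) \<Rightarrow> ('m \<Rightarrow> real) \<Rightarrow> 'm set set" where
  "demand b p v = {S \<in> affordable b p. \<forall>S'\<in>affordable b p. 
     (\<Sum>j\<in>S'. v j - p j) \<le> (\<Sum>j\<in>S. v j - p j)}"

text \<open>Taking the maximal payment over the demanded sets breaks ties in favor of the seller.\<close>

definition item_payment :: "real \<Rightarrow> ('m::finite \<Rightarrow> real) \<Rightarrow> 'm payment" where
  "item_payment b p v = Max ((\<lambda>S. \<Sum>j\<in>S. p j) ` demand b p v)"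

definition srev_set :: "real \<Rightarrow> ('m::finite \<Rightarrow> real) pmf \<Rightarrow> real set" where
  "srev_set b V = {exp_payment V (item_payment b p) | p. \<forall>j. 0 \<le> p j}"

definition SRev :: "real \<Rightarrow> ('m::finite \<Rightarrow> real) pmf \<Rightarrow> real" where
  "SRev b V = Sup (srev_set b V)"

definition brev_set :: "real \<Rightarrow> ('m::finite \<Rightarrow> real) pmf \<Rightarrow> real set" where
  "brev_set b V = {p * measure_pmf.prob V {v. norm1 v \<ge> p} | p. 0 \<le> p \<and> p \<le> b}"

definition BRev :: "real \<Rightarrow> ('m::finite \<Rightarrow> real) pmf \<Rightarrow> real" where
  "BRev b V = Sup (brev_set b V)"

lemma exp_payment_le:
  assumes "finite (set_pmf V)" "\<And>t. t \<in> set_pmf V \<Longrightarrow> p t \<le> b"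
  shows "exp_payment V p \<le> b"
proof -
  have "exp_payment V p \<le> (\<Sum>t\<in>set_pmf V. pmf V t * b)"
    unfolding exp_payment_def by (intro sum_mono mult_left_mono assms) auto
  also have "\<dots> = b"
    using sum_pmf_eq_1[OF assms(1) order_refl] by (simp flip: sum_distrib_right)
  finally show ?thesis .
qed

lemma demand_nonempty:
  assumes "b > 0"
  shows "demand b p v \<noteq> {}"
proof -
  have ne: "finite (affordable b p)" "affordable b p \<noteq> {}"
    using assms by (auto simp: affordable_def intro!: exI[of _ "{}"])
  define g where "g = (\<lambda>S. \<Sum>j\<in>S. v j - p j)"
  have "Max (g ` affordable b p) \<in> g ` affordable b p"
    using ne by (intro Max_in) auto
  then obtain S where S: "S \<in> affordable b p" "g S = Max (g ` affordable b p)"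
    by auto
  have "\<forall>S'\<in>affordable b p. g S' \<le> g S"
    using ne S by auto
  with S show ?thesis
    by (auto simp: demand_def g_def)
qed

lemma item_payment_le:
  assumes "b > 0"
  shows "item_payment b p v \<le> b"
  unfolding item_payment_def using demand_nonempty[OF assms, of p v]
  by (subst Max_le_iff) (auto simp: demand_def affordable_def)

lemma rev_set_bdd:
  assumes "b > 0" "finite (set_pmf V)"
  shows "rev_set b V \<noteq> {}" "x \<in> rev_set b V \<Longrightarrow> x \<le> b"
proof -
  have "exp_payment V (\<lambda>_. 0) \<in> rev_set b V"
    unfolding rev_set_def using assms
    by (auto simp: mechanism_def truthful_def utility_def intro!: exI[of _ "\<lambda>_ _. 0"] exI[of _ "\<lambda>_. 0"])
  then show "rev_set b V \<noteq> {}" by blast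
  show "x \<in> rev_set b V \<Longrightarrow> x \<le> b"
    using assms by (auto simp: rev_set_def intro!: exp_payment_le)
qed

lemma srev_set_bdd:
  assumes "b > 0" "finite (set_pmf V)"
  shows "srev_set b V \<noteq> {}" "x \<in> srev_set b V \<Longrightarrow> x \<le> b"
  using assms by (auto simp: srev_set_def intro!: exp_payment_le item_payment_le exI[of _ "\<lambda>_. 0"])

lemma brev_set_bdd:
  assumes "b > 0"
  shows "brev_set b V \<noteq> {}" "x \<in> brev_set b V \<Longrightarrow> x \<le> b"
proof -
  show "brev_set b V \<noteq> {}"
    using assms by (auto simp: brev_set_def intro!: exI[of _ 0])
  have "p * measure_pmf.prob V A \<le> b" if "0 \<le> p" "p \<le> b" for p A
    using mult_left_le[OF measure_pmf.prob_le_1[of V A] that(1)] that(2) by linarith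
  then show "x \<in> brev_set b V \<Longrightarrow> x \<le> b"
    by (auto simp: brev_set_def)
qed

end

theory Submission
  imports Defs
begin

text \<open>
  Types with \<open>norm1 t \<ge> b / 2\<close> pay at most \<open>b\<close> each, hence contribute at most \<open>2 * BRev\<close>; on the
  other types individual rationality keeps payments below the budget, which thus plays no role. There, let
  \<open>j\<close> be the favourite item of \<open>t\<close> and hand the buyer the value \<open>\<Sum>k\<noteq>j. q t k * t k\<close> in cash instead
  of the items \<open>k \<noteq> j\<close>. For fixed values of the other items this is a truthful single-item
  mechanism, which earns at most the optimal posted-price revenue \<open>r j\<close> with price in \<open>[0, b / 2]\<close>.
  Put \<open>\<rho> = (\<Sum>j. r j)\<close>. The cash is split at the level \<open>\<rho>\<close>. Non-favourite values above \<open>\<rho>\<close> cost at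
  most \<open>BRev\<close>, since \<open>x * Pr[some other item is worth \<ge> x] \<le> BRev\<close> and \<open>\<Sum>k. Pr[t k > \<rho>] \<le> 1\<close>.
  Values up to \<open>\<rho>\<close> have expected sum \<open>\<mu>\<close> and variance at most \<open>2 * \<rho>\<^sup>2\<close>, so by Chebyshev the
  bundle sells at price \<open>\<mu> - 2 * \<rho>\<close> (or \<open>b\<close>) with probability at least \<open>1 / 2\<close>. Altogether
  \<open>Rev \<le> 5 * BRev + 3 * \<rho>\<close> unless already \<open>b \<le> 2 * BRev\<close>.

  Posting the optimal single-item prices, all at most \<open>b / 2\<close>, makes the buyer pay at least
  \<open>min (sum of the prices he accepts) (b / 2)\<close>, because an accepted item left out does not fit
  into the remaining budget. Hence \<open>SRev \<ge> b / 2 * (1 - exp (- \<rho> / (b / 2)))\<close>, which is at least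
  \<open>3 / 5 * \<rho>\<close> if \<open>\<rho> \<le> b / 2\<close>, and at least \<open>3 / 5 * (b / 2)\<close> otherwise.
\<close>

section \<open>Selling a single item\<close>

text \<open>
  The reference point \<open>(q0, p0)\<close> is the allocation and payment of the next lower type; this is
  what makes the induction from the bottom type upwards work.
\<close>

lemma single_item_revenue_sum:
  fixes w q p :: "real \<Rightarrow> real"
  assumes "finite A" "\<And>x. x \<in> A \<Longrightarrow> 0 \<le> w x" "0 \<le> R" "q0 \<le> Q"
    and IC: "\<And>x y. x \<in> A \<Longrightarrow> y \<in> A \<Longrightarrow> q y * x - p y \<le> q x * x - p x"
    and base: "\<And>x. x \<in> A \<Longrightarrow> p x - p0 \<le> x * (q x - q0)"
    and q: "\<And>x. x \<in> A \<Longrightarrow> q0 \<le> q x \<and> q x \<le> Q"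
    and R: "\<And>t. t \<in> A \<Longrightarrow> t * (\<Sum>x\<in>{x\<in>A. t \<le> x}. w x) \<le> R"
  shows "(\<Sum>x\<in>A. w x * (p x - p0)) \<le> R * (Q - q0)"
  using assms
proof (induction A arbitrary: p0 q0 rule: finite_linorder_min_induct)
  case empty
  then show ?case by simp
next
  case (insert a A)
  let ?w = "\<Sum>x\<in>insert a A. w x"
  have a: "a \<notin> A" using insert.hyps by auto
  have mono: "q a \<le> q x" if "x \<in> A" for x
  proof -
    have "(x - a) * (q x - q a) \<ge> 0"
      using insert.prems(4)[of a x] insert.prems(4)[of x a] that by (simp add: algebra_simps)
    then show ?thesis using insert.hyps(2) that by (auto simp: zero_le_mult_iff)
  qed
  have tail: "t * (\<Sum>x\<in>{x\<in>A. t \<le> x}. w x) \<le> R" if "t \<in> A" for t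
  proof -
    have "{x \<in> insert a A. t \<le> x} = {x \<in> A. t \<le> x}"
      using that insert.hyps(2) by fastforce
    then show ?thesis using insert.prems(7)[of t] that by simp
  qed
  have IH: "(\<Sum>x\<in>A. w x * (p x - p a)) \<le> R * (Q - q a)"
  proof (rule insert.IH)
    show "p x - p a \<le> x * (q x - q a)" if "x \<in> A" for x
      using insert.prems(4)[of x a] that by (simp add: algebra_simps)
  qed (use insert.prems mono tail in auto)
  have "{x \<in> insert a A. a \<le> x} = insert a A" using insert.hyps(2) by fastforce
  then have aR: "a * ?w \<le> R" using insert.prems(7)[of a] by simp
  have w0: "0 \<le> ?w" using insert.prems(1) by (intro sum_nonneg) auto
  have "?w * (p a - p0) \<le> ?w * (a * (q a - q0))"
    using insert.prems(5)[of a] w0 by (intro mult_left_mono) auto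
  also have "\<dots> = (a * ?w) * (q a - q0)" by simp
  also have "\<dots> \<le> R * (q a - q0)"
    using aR insert.prems(6)[of a] by (intro mult_right_mono) auto
  finally have 1: "?w * (p a - p0) \<le> R * (q a - q0)" .
  have "(\<Sum>x\<in>insert a A. w x * (p x - p0))
      = (\<Sum>x\<in>insert a A. w x * (p a - p0) + w x * (p x - p a))"
    by (intro sum.cong) (auto simp: algebra_simps)
  also have "\<dots> = ?w * (p a - p0) + (\<Sum>x\<in>A. w x * (p x - p a))"
    using a insert.hyps(1) by (simp add: sum.distrib flip: sum_distrib_right)
  also have "\<dots> \<le> R * (Q - q0)" using 1 IH by (simp add: algebra_simps)
  finally show ?case .
qed

lemma single_item_revenue:
  fixes M :: "real pmf" and q p :: "real \<Rightarrow> real"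
  assumes fin: "finite (set_pmf M)" and "0 \<le> R" "0 \<le> Q" and A: "A \<subseteq> set_pmf M"
    and IC: "\<And>x y. x \<in> A \<Longrightarrow> y \<in> A \<Longrightarrow> q y * x - p y \<le> q x * x - p x"
    and IR: "\<And>x. x \<in> A \<Longrightarrow> p x \<le> q x * x"
    and q: "\<And>x. x \<in> A \<Longrightarrow> 0 \<le> q x \<and> q x \<le> Q"
    and R: "\<And>t. t \<in> A \<Longrightarrow> t * measure_pmf.prob M {t..} \<le> R"
    and nn: "\<And>t. t \<in> A \<Longrightarrow> 0 \<le> t"
  shows "measure_pmf.expectation M (\<lambda>x. if x \<in> A then p x else 0) \<le> R * Q"
proof -
  have finA: "finite A" using fin A finite_subset by auto
  have tail: "t * (\<Sum>x\<in>{x\<in>A. t \<le> x}. pmf M x) \<le> R" if "t \<in> A" for t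
  proof -
    have "(\<Sum>x\<in>{x\<in>A. t \<le> x}. pmf M x) = measure_pmf.prob M {x\<in>A. t \<le> x}"
      using finA by (simp add: measure_measure_pmf_finite)
    also have "\<dots> \<le> measure_pmf.prob M {t..}"
      by (intro measure_pmf.finite_measure_mono) auto
    finally have "t * (\<Sum>x\<in>{x\<in>A. t \<le> x}. pmf M x) \<le> t * measure_pmf.prob M {t..}"
      using nn[OF that] by (intro mult_left_mono)
    also have "\<dots> \<le> R" by (rule R[OF that])
    finally show ?thesis .
  qed
  have "measure_pmf.expectation M (\<lambda>x. if x \<in> A then p x else 0) = (\<Sum>x\<in>A. pmf M x * (p x - 0))"
    by (subst integral_measure_pmf_real[OF finA]) (auto split: if_splits intro: sum.cong)
  also have "\<dots> \<le> R * (Q - 0)"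
    using assms tail finA by (intro single_item_revenue_sum) (auto simp: mult.commute)
  finally show ?thesis by simp
qed

lemma optimal_price_exists:
  fixes M :: "real pmf"
  assumes fin: "finite (set_pmf M)" and "0 \<le> B"
  shows "\<exists>P. 0 \<le> P \<and> P \<le> B \<and>
    (\<forall>x. 0 \<le> x \<longrightarrow> x \<le> B \<longrightarrow> x * measure_pmf.prob M {x..} \<le> P * measure_pmf.prob M {P..})"
proof -
  define C where "C = insert B (set_pmf M \<inter> {0..B})"
  let ?g = "\<lambda>x. x * measure_pmf.prob M {x..}"
  have C: "finite C" "C \<noteq> {}" using fin by (auto simp: C_def)
  then have "Max (?g ` C) \<in> ?g ` C" by (intro Max_in) auto
  then obtain P where P: "P \<in> C" "?g P = Max (?g ` C)" by auto
  have PC: "?g y \<le> ?g P" if "y \<in> C" for y using C P that by auto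
  have "?g x \<le> ?g P" if x: "0 \<le> x" "x \<le> B" for x
  proof -
    define y where "y = Min {y \<in> C. x \<le> y}"
    have D: "finite {y \<in> C. x \<le> y}" using C(1) by simp
    have "B \<in> {y \<in> C. x \<le> y}" using x by (simp add: C_def)
    then have D': "{y \<in> C. x \<le> y} \<noteq> {}" by blast
    have y: "y \<in> C" "x \<le> y" using Min_in[OF D D'] by (auto simp: y_def)
    have "y \<le> z" if "z \<in> set_pmf M" "x \<le> z" for z
    proof (cases "z \<le> B")
      case True
      then have "z \<in> {y \<in> C. x \<le> y}" using that x by (auto simp: C_def)
      then show ?thesis using D by (simp add: y_def)
    next
      case False
      have "y \<le> B" using y by (auto simp: C_def)
      with False show ?thesis by simp
    qed
    then have "measure_pmf.prob M {x..} = measure_pmf.prob M {y..}"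
      using y by (intro measure_pmf.finite_measure_eq_AE) (auto simp: AE_measure_pmf_iff)
    then have "?g x \<le> ?g y" using y by (simp add: mult_right_mono)
    also have "\<dots> \<le> ?g P" using PC y by simp
    finally show ?thesis .
  qed
  moreover have "0 \<le> P" "P \<le> B" using P(1) \<open>0 \<le> B\<close> by (auto simp: C_def)
  ultimately show ?thesis by blast
qed

section \<open>Product distributions\<close>

lemma Pi_pmf_resample:
  fixes W :: "'m::finite \<Rightarrow> 'a pmf"
  shows "Pi_pmf UNIV d W = bind_pmf (Pi_pmf UNIV d W) (\<lambda>s. map_pmf (\<lambda>x. s(j := x)) (W j))"
proof -
  have "Pi_pmf UNIV d W = Pi_pmf (insert j (UNIV - {j})) d W"
    by (simp add: insert_absorb)
  also have "\<dots> = do {y \<leftarrow> W j; f \<leftarrow> Pi_pmf (UNIV - {j}) d W; return_pmf (f(j := y))}"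
    by (rule Pi_pmf_insert') auto
  finally have V: "Pi_pmf UNIV d W =
    do {y \<leftarrow> W j; f \<leftarrow> Pi_pmf (UNIV - {j}) d W; return_pmf (f(j := y))}" .
  show ?thesis
    by (simp add: V map_pmf_def bind_assoc_pmf bind_return_pmf bind_pmf_const
        bind_commute_pmf[of "W j" "Pi_pmf (UNIV - {j}) d W"])
qed

lemma expectation_Pi_pmf_resample:
  fixes W :: "'m::finite \<Rightarrow> 'a pmf" and F :: "('m \<Rightarrow> 'a) \<Rightarrow> real"
  assumes fin: "\<And>j. finite (set_pmf (W j))"
  shows "measure_pmf.expectation (Pi_pmf UNIV d W) F =
    measure_pmf.expectation (Pi_pmf UNIV d W)
      (\<lambda>s. measure_pmf.expectation (W j) (\<lambda>x. F (s(j := x))))"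
proof -
  let ?V = "Pi_pmf UNIV d W"
  have finV: "finite (set_pmf ?V)"
    using fin by (simp add: set_Pi_pmf finite_PiE_dflt)
  have "measure_pmf.expectation ?V F =
    measure_pmf.expectation (bind_pmf ?V (\<lambda>s. map_pmf (\<lambda>x. s(j := x)) (W j))) F"
    by (subst Pi_pmf_resample[of d W j]) (rule refl)
  also have "\<dots> = measure_pmf.expectation ?V
      (\<lambda>s. measure_pmf.expectation (W j) (\<lambda>x. F (s(j := x))))"
    using fin finV
    by (subst pmf_expectation_bind[OF finV]) (auto simp: integral_measure_pmf[OF finV])
  finally show ?thesis .
qed

lemma expectation_pmf_swap:
  fixes f :: "'a \<Rightarrow> 'b \<Rightarrow> real"
  assumes "finite (set_pmf M)" "finite (set_pmf N)"
  shows "measure_pmf.expectation M (\<lambda>x. measure_pmf.expectation N (f x)) =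
    measure_pmf.expectation N (\<lambda>y. measure_pmf.expectation M (\<lambda>x. f x y))"
  using assms
  by (simp add: integral_measure_pmf[of "set_pmf M"] integral_measure_pmf[of "set_pmf N"]
      sum_distrib_left sum.swap[of _ "set_pmf N"] mult.left_commute)

lemma expectation_Pi_pmf_component:
  fixes W :: "'m::finite \<Rightarrow> 'a pmf" and h :: "'a \<Rightarrow> real"
  assumes "\<And>j. finite (set_pmf (W j))"
  shows "measure_pmf.expectation (Pi_pmf UNIV d W) (\<lambda>t. h (t k)) = measure_pmf.expectation (W k) h"
  by (subst expectation_Pi_pmf_resample[OF assms, where j = k]) simp

lemma expectation_Pi_pmf_sum_square:
  fixes W :: "'m::finite \<Rightarrow> 'a pmf" and g :: "'m \<Rightarrow> 'a \<Rightarrow> real"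
  assumes fin: "\<And>j. finite (set_pmf (W j))"
    and zero: "\<And>k. measure_pmf.expectation (W k) (g k) = 0"
  shows "measure_pmf.expectation (Pi_pmf UNIV d W) (\<lambda>t. (\<Sum>k\<in>UNIV. g k (t k))\<^sup>2) =
    (\<Sum>k\<in>UNIV. measure_pmf.expectation (W k) (\<lambda>x. (g k x)\<^sup>2))"
proof -
  let ?V = "Pi_pmf UNIV d W"
  have int: "integrable (measure_pmf ?V) F" for F :: "_ \<Rightarrow> real"
    using fin by (intro integrable_measure_pmf_finite) (simp add: set_Pi_pmf finite_PiE_dflt)
  have *: "measure_pmf.expectation ?V (\<lambda>t. g j (t j) * g k (t k)) =
      (if j = k then measure_pmf.expectation (W k) (\<lambda>x. (g k x)\<^sup>2) else 0)" for j k
    by (subst expectation_Pi_pmf_resample[OF fin, where j = j])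
      (auto simp: zero power2_eq_square)
  show ?thesis
    by (simp add: power2_eq_square sum_product int Bochner_Integration.integral_sum *)
qed

section \<open>Item pricing\<close>

lemma item_payment_ge:
  assumes "b > 0" and p: "\<And>j. 0 \<le> p j" "\<And>j. p j \<le> b / 2"
  shows "min (\<Sum>j\<in>{j. p j \<le> v j}. p j) (b / 2) \<le> item_payment b p v"
proof -
  have "finite (demand b p v)" by simp
  then have "item_payment b p v \<in> (\<lambda>S. \<Sum>j\<in>S. p j) ` demand b p v"
    unfolding item_payment_def using demand_nonempty[OF assms(1)] by (intro Max_in) auto
  then obtain S where S: "S \<in> demand b p v" "item_payment b p v = sum p S" by auto
  have max: "sum p S' \<le> sum p S" if "S' \<in> demand b p v" for S'
    using that unfolding S(2)[symmetric] item_payment_def by (intro Max_ge) auto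
  have unaffordable: "b < sum p S + p j" if j: "j \<notin> S" "p j \<le> v j" "0 < p j" for j
  proof (rule ccontr)
    assume "\<not> ?thesis"
    then have aff: "insert j S \<in> affordable b p"
      using j by (simp add: affordable_def)
    have "(\<Sum>k\<in>S. v k - p k) \<le> (\<Sum>k\<in>insert j S. v k - p k)"
      using j by simp
    then have "insert j S \<in> demand b p v"
      using S(1) aff unfolding demand_def by fastforce
    from max[OF this] j show False by simp
  qed
  show ?thesis
  proof (cases "\<exists>j. j \<notin> S \<and> p j \<le> v j \<and> 0 < p j")
    case True
    then obtain j where "b < sum p S + p j" using unaffordable by blast
    then show ?thesis using p(2)[of j] S(2) by linarith
  next
    case False
    have "(\<Sum>j\<in>{j. p j \<le> v j}. p j) = (\<Sum>j\<in>{j. p j \<le> v j \<and> 0 < p j}. p j)"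
      by (intro sum.mono_neutral_right) (use p(1) in \<open>auto simp: order.order_iff_strict\<close>)
    also have "\<dots> \<le> sum p S"
      using False p(1) by (intro sum_mono2) auto
    finally have "(\<Sum>j\<in>{j. p j \<le> v j}. p j) \<le> sum p S" .
    then show ?thesis using S(2) by simp
  qed
qed

lemma one_minus_prod_le_min_sum:
  fixes x :: "'a \<Rightarrow> real"
  assumes "finite A" "\<And>i. i \<in> A \<Longrightarrow> 0 \<le> x i \<and> x i \<le> 1"
  shows "1 - (\<Prod>i\<in>A. 1 - x i) \<le> min (\<Sum>i\<in>A. x i) 1"
  using assms
proof (induction A rule: finite_induct)
  case (insert a A)
  have "0 \<le> (\<Prod>i\<in>A. 1 - x i)" "(\<Prod>i\<in>A. 1 - x i) \<le> 1"
    using insert.prems by (auto intro!: prod_nonneg prod_le_1)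
  then have "x a * (\<Prod>i\<in>A. 1 - x i) \<le> x a" "0 \<le> (1 - x a) * (\<Prod>i\<in>A. 1 - x i)"
    using insert.prems by (auto intro: mult_left_le)
  then show ?case using insert by (auto simp: algebra_simps)
qed auto

lemma exp_minus_le_chord:
  fixes x :: real
  assumes "0 \<le> x" "x \<le> 1"
  shows "3 / 5 * x \<le> 1 - exp (- x)"
proof -
  have 1: "1 + x + x\<^sup>2 / 2 \<le> exp x" using assms by (intro exp_lower_Taylor_quadratic)
  have "x\<^sup>2 \<le> x" using assms by (simp add: power2_eq_square mult_left_le)
  then have "0 \<le> x * (4 - x - 3 * x\<^sup>2)" using assms by (intro mult_nonneg_nonneg) auto
  then have "1 \<le> (1 - 3 / 5 * x) * (1 + x + x\<^sup>2 / 2)"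
    by (simp add: algebra_simps power2_eq_square)
  also have "\<dots> \<le> (1 - 3 / 5 * x) * exp x" using assms 1 by (intro mult_left_mono) auto
  finally have "exp (- x) * 1 \<le> exp (- x) * ((1 - 3 / 5 * x) * exp x)"
    by (intro mult_left_mono) auto
  also have "\<dots> = 1 - 3 / 5 * x" by (simp add: exp_minus)
  finally show ?thesis by simp
qed


section \<open>The revenue bound\<close>

text \<open>\<open>P j\<close> is an optimal posted price for item \<open>j\<close> among the prices up to \<open>b / 2\<close>.\<close>

locale budgeted_product =
  fixes b :: real and W :: "'m::finite \<Rightarrow> real pmf" and P :: "'m \<Rightarrow> real"
  assumes b_pos: "0 < b"
    and fin: "finite (set_pmf (W j))"
    and nonneg: "set_pmf (W j) \<subseteq> {0..}"
    and P_nonneg: "0 \<le> P j"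
    and P_le: "P j \<le> b / 2"
    and P_opt: "0 \<le> x \<Longrightarrow> x \<le> b / 2 \<Longrightarrow>
      x * measure_pmf.prob (W j) {x..} \<le> P j * measure_pmf.prob (W j) {P j..}"
begin

definition V :: "('m \<Rightarrow> real) pmf" where
  "V = Pi_pmf UNIV 0 W"

definition r :: "'m \<Rightarrow> real" where
  "r j = P j * measure_pmf.prob (W j) {P j..}"

definition \<rho> :: real where
  "\<rho> = (\<Sum>j\<in>UNIV. r j)"

lemma set_pmf_V: "t \<in> set_pmf V \<longleftrightarrow> (\<forall>j. t j \<in> set_pmf (W j))"
  by (simp add: V_def set_Pi_pmf PiE_dflt_def)

lemma fin_V: "finite (set_pmf V)"
  using fin by (simp add: V_def set_Pi_pmf finite_PiE_dflt)

lemma integrable_V [simp]: "integrable (measure_pmf V) F" for F :: "_ \<Rightarrow> real"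
  by (intro integrable_measure_pmf_finite fin_V)

lemma integrable_W [simp]: "integrable (measure_pmf (W j)) F" for F :: "_ \<Rightarrow> real"
  by (intro integrable_measure_pmf_finite fin)

lemma V_nonneg: "t \<in> set_pmf V \<Longrightarrow> 0 \<le> t j"
  using nonneg[of j] by (auto simp: set_pmf_V)

lemma le_norm1: "t j \<le> norm1 t"
proof -
  have "t j \<le> \<bar>t j\<bar>" by simp
  also have "\<dots> \<le> norm1 t" unfolding norm1_def by (intro member_le_sum) auto
  finally show ?thesis .
qed

lemma exp_payment_V: "exp_payment V F = measure_pmf.expectation V F"
  using integral_measure_pmf_real[OF fin_V, of V F] by (simp add: exp_payment_def mult.commute)

lemma expectation_mono:
  fixes F G :: "('m \<Rightarrow> real) \<Rightarrow> real"
  assumes "\<And>t. t \<in> set_pmf V \<Longrightarrow> F t \<le> G t"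
  shows "measure_pmf.expectation V F \<le> measure_pmf.expectation V G"
  using assms by (intro integral_mono_AE) (auto simp: AE_measure_pmf_iff)

lemma r_nonneg: "0 \<le> r j"
  by (simp add: r_def P_nonneg)

lemma r_le_\<rho>: "r j \<le> \<rho>"
  unfolding \<rho>_def by (intro member_le_sum) (auto simp: r_nonneg)

lemma \<rho>_nonneg: "0 \<le> \<rho>"
  by (simp add: \<rho>_def sum_nonneg r_nonneg)

lemma BRev_ge:
  assumes "0 \<le> x" "x \<le> b"
  shows "x * measure_pmf.prob V {v. x \<le> norm1 v} \<le> BRev b V"
  unfolding BRev_def
proof (rule cSup_upper)
  show "bdd_above (brev_set b V)" by (rule bdd_aboveI) (rule brev_set_bdd(2)[OF b_pos])
qed (use assms in \<open>auto simp: brev_set_def\<close>)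

lemma BRev_nonneg: "0 \<le> BRev b V"
  using BRev_ge[of 0] b_pos by simp

lemma SRev_ge: "b / 2 * (1 - exp (- (\<rho> / (b / 2)))) \<le> SRev b V"
proof -
  define B where "B = b / 2"
  have B: "0 < B" using b_pos by (simp add: B_def)
  define X where "X = (\<lambda>j x. P j * indicator {P j..} x / B :: real)"
  have PB: "P j \<le> B" for j using P_le by (simp add: B_def)
  have X01: "0 \<le> X j x \<and> X j x \<le> 1" for j x
    using P_nonneg[of j] PB[of j] B by (auto simp: X_def indicator_def)
  have EX: "measure_pmf.expectation (W j) (\<lambda>x. 1 - X j x) = 1 - r j / B" for j
    by (simp add: X_def r_def)
  have r1: "0 \<le> 1 - r j / B" for j
    unfolding EX[symmetric] using X01 by (intro Bochner_Integration.integral_nonneg) auto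
  have "(\<Prod>j\<in>UNIV. 1 - r j / B) \<le> (\<Prod>j\<in>UNIV. exp (- (r j / B)))"
    using r1 exp_ge_add_one_self[of "- (r j / B)" for j] by (intro prod_mono) auto
  also have "\<dots> = exp (- (\<rho> / B))"
    by (simp add: exp_sum[symmetric] \<rho>_def sum_negf sum_divide_distrib)
  finally have "B * (1 - exp (- (\<rho> / B))) \<le> B * (1 - (\<Prod>j\<in>UNIV. 1 - r j / B))"
    using B by simp
  also have "(\<Prod>j\<in>UNIV. 1 - r j / B) = measure_pmf.expectation V (\<lambda>t. \<Prod>j\<in>UNIV. 1 - X j (t j))"
    unfolding V_def EX[symmetric] by (rule expectation_prod_Pi_pmf[symmetric]) (auto simp: X01)
  also have "B * (1 - \<dots>) = measure_pmf.expectation V (\<lambda>t. B * (1 - (\<Prod>j\<in>UNIV. 1 - X j (t j))))"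
    by simp
  also have "\<dots> \<le> measure_pmf.expectation V (item_payment b P)"
  proof (rule expectation_mono)
    fix t
    have "B * (1 - (\<Prod>j\<in>UNIV. 1 - X j (t j))) \<le> B * min (\<Sum>j\<in>UNIV. X j (t j)) 1"
      using B X01 by (intro mult_left_mono one_minus_prod_le_min_sum) auto
    also have "\<dots> = min (\<Sum>j\<in>UNIV. B * X j (t j)) B"
      using B by (auto simp: min_def sum_distrib_left[symmetric])
    also have "(\<Sum>j\<in>UNIV. B * X j (t j)) = (\<Sum>j\<in>{j. P j \<le> t j}. P j)"
      using B by (intro sum.mono_neutral_cong_right) (auto simp: X_def indicator_def)
    also have "min \<dots> B \<le> item_payment b P t"
      unfolding B_def by (rule item_payment_ge[OF b_pos P_nonneg P_le])
    finally show "B * (1 - (\<Prod>j\<in>UNIV. 1 - X j (t j))) \<le> item_payment b P t" .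
  qed
  also have "\<dots> = exp_payment V (item_payment b P)" by (simp add: exp_payment_V)
  also have "\<dots> \<le> SRev b V"
    unfolding SRev_def
  proof (rule cSup_upper)
    show "bdd_above (srev_set b V)"
      by (rule bdd_aboveI) (rule srev_set_bdd(2)[OF b_pos fin_V])
  qed (use P_nonneg in \<open>auto simp: srev_set_def\<close>)
  finally show ?thesis by (simp add: B_def)
qed

lemma SRev_ge_\<rho>: "\<rho> \<le> b / 2 \<Longrightarrow> 3 / 5 * \<rho> \<le> SRev b V"
proof -
  assume "\<rho> \<le> b / 2"
  then have "3 / 5 * (\<rho> / (b / 2)) \<le> 1 - exp (- (\<rho> / (b / 2)))"
    using b_pos \<rho>_nonneg by (intro exp_minus_le_chord) (auto simp: field_simps)
  then have "b / 2 * (3 / 5 * (\<rho> / (b / 2))) \<le> b / 2 * (1 - exp (- (\<rho> / (b / 2))))"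
    using b_pos by (intro mult_left_mono) auto
  also have "\<dots> \<le> SRev b V" by (rule SRev_ge)
  finally show ?thesis using b_pos by simp
qed

lemma SRev_ge_b:
  assumes "b / 2 \<le> \<rho>"
  shows "3 / 5 * (b / 2) \<le> SRev b V"
proof -
  have "3 / 5 * 1 \<le> 1 - exp (- 1 :: real)" by (rule exp_minus_le_chord) auto
  moreover have "exp (- (\<rho> / (b / 2))) \<le> exp (- 1 :: real)"
    using assms b_pos by (simp add: field_simps)
  ultimately have "3 / 5 \<le> 1 - exp (- (\<rho> / (b / 2)))" by linarith
  then have "b / 2 * (3 / 5) \<le> b / 2 * (1 - exp (- (\<rho> / (b / 2))))"
    using b_pos by (intro mult_left_mono) auto
  also have "\<dots> \<le> SRev b V" by (rule SRev_ge)
  finally show ?thesis by simp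
qed

definition core :: "real \<Rightarrow> real" where
  "core x = (if x \<le> \<rho> then x else 0)"

text \<open>The pair \<open>q x = 2 * x\<close>, \<open>p x = x\<^sup>2\<close> is truthful, so Myerson's bound controls second moments.\<close>

lemma core_second_moment:
  assumes "\<rho> \<le> b / 2"
  shows "measure_pmf.expectation (W k) (\<lambda>x. (core x)\<^sup>2) \<le> 2 * \<rho> * r k"
proof -
  let ?A = "{x \<in> set_pmf (W k). x \<le> \<rho>}"
  have nn: "0 \<le> x" if "x \<in> ?A" for x using that nonneg[of k] by auto
  have "measure_pmf.expectation (W k) (\<lambda>x. if x \<in> ?A then x\<^sup>2 else 0) \<le> r k * (2 * \<rho>)"
  proof (rule single_item_revenue[where q = "\<lambda>x. 2 * x"])
    show "2 * y * x - y\<^sup>2 \<le> 2 * x * x - x\<^sup>2" for x y :: real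
      using zero_le_power2[of "x - y"] by (simp add: power2_eq_square algebra_simps)
    show "x\<^sup>2 \<le> 2 * x * x" for x :: real by (simp add: power2_eq_square)
    show "t * measure_pmf.prob (W k) {t..} \<le> r k" if "t \<in> ?A" for t
      using P_opt[of t k] nn[OF that] that assms by (simp add: r_def)
    show "0 \<le> 2 * x \<and> 2 * x \<le> 2 * \<rho>" if "x \<in> ?A" for x using nn[OF that] that by simp
  qed (use fin r_nonneg \<rho>_nonneg nn in auto)
  also have "measure_pmf.expectation (W k) (\<lambda>x. if x \<in> ?A then x\<^sup>2 else 0)
      = measure_pmf.expectation (W k) (\<lambda>x. (core x)\<^sup>2)"
    by (intro integral_cong_AE) (auto simp: AE_measure_pmf_iff core_def)
  finally show ?thesis by (simp add: mult.commute mult.left_commute)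
qed

lemma core_bound:
  assumes \<rho>: "\<rho> \<le> b / 2"
  defines "\<mu> \<equiv> (\<Sum>k\<in>UNIV. measure_pmf.expectation (W k) core)"
  shows "min (\<mu> - 2 * \<rho>) b \<le> 2 * BRev b V"
proof (cases "\<mu> - 2 * \<rho> \<le> 0")
  case True
  then show ?thesis using BRev_nonneg by linarith
next
  case False
  have "\<rho> \<noteq> 0"
  proof
    assume "\<rho> = 0"
    then have "\<mu> \<le> 0" unfolding \<mu>_def core_def
      by (intro sum_nonpos measure_pmf.integral_le_const) auto
    with False \<open>\<rho> = 0\<close> show False by simp
  qed
  then have \<rho>_pos: "0 < \<rho>" using \<rho>_nonneg by simp
  define m where "m k = measure_pmf.expectation (W k) core" for k
  define S where "S t = (\<Sum>k\<in>UNIV. core (t k))" for t :: "'m \<Rightarrow> real"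
  define Z where "Z = {t. S t < \<mu> - 2 * \<rho>}"
  have "(2 * \<rho>)\<^sup>2 * measure_pmf.prob V Z = measure_pmf.expectation V (\<lambda>t. (2 * \<rho>)\<^sup>2 * indicator Z t)"
    by simp
  also have "\<dots> \<le> measure_pmf.expectation V (\<lambda>t. (\<Sum>k\<in>UNIV. core (t k) - m k)\<^sup>2)"
  proof (rule expectation_mono)
    fix t
    show "(2 * \<rho>)\<^sup>2 * indicator Z t \<le> (\<Sum>k\<in>UNIV. core (t k) - m k)\<^sup>2"
    proof (cases "t \<in> Z")
      case True
      then have "2 * \<rho> \<le> - (S t - \<mu>)" by (simp add: Z_def)
      then have "(2 * \<rho>)\<^sup>2 \<le> (- (S t - \<mu>))\<^sup>2" using \<rho>_pos by (intro power_mono) auto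
      then show ?thesis using True
        by (simp add: S_def \<mu>_def m_def sum_subtractf power2_commute)
    qed simp
  qed
  also have "\<dots> = (\<Sum>k\<in>UNIV. measure_pmf.expectation (W k) (\<lambda>x. (core x - m k)\<^sup>2))"
    unfolding V_def by (rule expectation_Pi_pmf_sum_square) (auto simp: fin m_def)
  also have "\<dots> \<le> (\<Sum>k\<in>UNIV. 2 * \<rho> * r k)"
  proof (rule sum_mono)
    fix k
    have "measure_pmf.expectation (W k) (\<lambda>x. (core x - m k)\<^sup>2)
        = measure_pmf.expectation (W k) (\<lambda>x. (core x)\<^sup>2) - (m k)\<^sup>2"
      using measure_pmf.variance_eq[of "W k" core] by (simp add: m_def)
    then show "measure_pmf.expectation (W k) (\<lambda>x. (core x - m k)\<^sup>2) \<le> 2 * \<rho> * r k"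
      using core_second_moment[OF \<rho>, of k] zero_le_power2[of "m k"] by linarith
  qed
  also have "\<dots> = 2 * \<rho>\<^sup>2" by (simp add: power2_eq_square flip: sum_distrib_left \<rho>_def)
  finally have "measure_pmf.prob V Z \<le> 1 / 2"
    using \<rho>_pos by (simp add: power2_eq_square)
  then have half: "1 / 2 \<le> measure_pmf.prob V (UNIV - Z)"
    using measure_pmf.prob_compl[of Z V] by simp
  define c where "c = min (\<mu> - 2 * \<rho>) b"
  have c: "0 \<le> c" "c \<le> b" using False b_pos by (auto simp: c_def)
  have "measure_pmf.prob V (UNIV - Z) \<le> measure_pmf.prob V {v. c \<le> norm1 v}"
  proof (rule measure_pmf.finite_measure_mono_AE)
    show "AE t in measure_pmf V. t \<in> UNIV - Z \<longrightarrow> t \<in> {v. c \<le> norm1 v}"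
    proof (clarsimp simp: AE_measure_pmf_iff)
      fix t assume t: "t \<in> set_pmf V" "t \<notin> Z"
      have "S t \<le> norm1 t" unfolding S_def norm1_def by (intro sum_mono) (auto simp: core_def)
      then show "c \<le> norm1 t" using t by (simp add: Z_def c_def)
    qed
  qed simp
  with half have "c * (1 / 2) \<le> c * measure_pmf.prob V {v. c \<le> norm1 v}"
    using c by (intro mult_left_mono) auto
  also have "\<dots> \<le> BRev b V" by (rule BRev_ge[OF c])
  finally show ?thesis by (simp add: c_def)
qed

definition tail :: "'m \<Rightarrow> ('m \<Rightarrow> real) \<Rightarrow> real" where
  "tail k t = (if \<rho> < t k \<and> t k < b / 2 \<and> (\<exists>l. l \<noteq> k \<and> t k \<le> t l) then t k else 0)"

text \<open>For \<open>\<rho> = 0\<close> the right-hand side is \<open>0\<close>, and no item then has a positive value below \<open>b / 2\<close>.\<close>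

lemma tail_prob:
  assumes "\<rho> \<le> b / 2"
  shows "measure_pmf.prob (W k) {x. \<rho> < x \<and> x < b / 2} \<le> r k / \<rho>"
proof (cases "\<rho> = 0")
  case True
  then have rk: "r k = 0" using r_le_\<rho>[of k] r_nonneg[of k] by simp
  have "x \<notin> set_pmf (W k)" if "0 < x" "x < b / 2" for x
  proof
    assume x: "x \<in> set_pmf (W k)"
    then have "0 < measure_pmf.prob (W k) {x..}"
      using measure_pmf_posI[OF x, of "{x..}"] by simp
    moreover have "x * measure_pmf.prob (W k) {x..} \<le> 0"
      using P_opt[of x k] that unfolding rk[unfolded r_def] by simp
    ultimately show False using that by (simp add: mult_le_0_iff)
  qed
  then have "measure_pmf.prob (W k) {x. \<rho> < x \<and> x < b / 2} = 0"
    using True by (auto simp: measure_pmf_zero_iff)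
  then show ?thesis using True by simp
next
  case False
  then have \<rho>: "0 < \<rho>" using \<rho>_nonneg by simp
  have "measure_pmf.prob (W k) {x. \<rho> < x \<and> x < b / 2} \<le> measure_pmf.prob (W k) {\<rho>..}"
    by (intro measure_pmf.finite_measure_mono) auto
  also have "\<dots> \<le> r k / \<rho>"
    using P_opt[of \<rho> k] \<rho> assms by (simp add: r_def field_simps)
  finally show ?thesis .
qed

lemma tail_bound:
  assumes \<rho>: "\<rho> \<le> b / 2"
  shows "(\<Sum>k\<in>UNIV. measure_pmf.expectation V (tail k)) \<le> BRev b V"
proof -
  have "measure_pmf.expectation V (tail k) \<le> r k / \<rho> * BRev b V" for k
  proof -
    let ?C = "{x. \<rho> < x \<and> x < b / 2}"
    have "measure_pmf.expectation V (tail k) =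
        measure_pmf.expectation V (\<lambda>s. measure_pmf.expectation (W k) (\<lambda>x. tail k (s(k := x))))"
      unfolding V_def by (rule expectation_Pi_pmf_resample[OF fin])
    also have "\<dots> = measure_pmf.expectation (W k) (\<lambda>x. measure_pmf.expectation V (\<lambda>s. tail k (s(k := x))))"
      by (rule expectation_pmf_swap[OF fin_V fin])
    also have "\<dots> \<le> measure_pmf.expectation (W k) (\<lambda>x. indicator ?C x * BRev b V)"
    proof (rule integral_mono)
      fix x
      show "measure_pmf.expectation V (\<lambda>s. tail k (s(k := x))) \<le> indicator ?C x * BRev b V"
      proof (cases "x \<in> ?C")
        case True
        then have x: "0 \<le> x" "x \<le> b" using \<rho>_nonneg b_pos by auto
        have "measure_pmf.expectation V (\<lambda>s. tail k (s(k := x)))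
            \<le> measure_pmf.expectation V (\<lambda>s. x * indicator {v. x \<le> norm1 v} s)"
        proof (rule expectation_mono)
          fix s
          show "tail k (s(k := x)) \<le> x * indicator {v. x \<le> norm1 v} s"
            using x order_trans[OF _ le_norm1[of s]] by (auto simp: tail_def indicator_def)
        qed
        also have "\<dots> = x * measure_pmf.prob V {v. x \<le> norm1 v}" by simp
        also have "\<dots> \<le> BRev b V" by (rule BRev_ge[OF x])
        finally show ?thesis using True by simp
      next
        case False
        then show ?thesis by (auto simp: tail_def)
      qed
    qed auto
    also have "\<dots> = measure_pmf.prob (W k) ?C * BRev b V" by simp
    also have "\<dots> \<le> r k / \<rho> * BRev b V"
      using tail_prob[OF \<rho>] BRev_nonneg by (intro mult_right_mono)
    finally show ?thesis .
  qed
  then have "(\<Sum>k\<in>UNIV. measure_pmf.expectation V (tail k)) \<le> (\<Sum>k\<in>UNIV. r k / \<rho> * BRev b V)"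
    by (intro sum_mono)
  also have "\<dots> = \<rho> / \<rho> * BRev b V"
    by (simp add: sum_distrib_right[symmetric] sum_divide_distrib[symmetric] flip: \<rho>_def)
  also have "\<dots> \<le> BRev b V" using BRev_nonneg by (cases "\<rho> = 0") auto
  finally show ?thesis .
qed

lemma single_bound:
  assumes q: "mechanism (set_pmf V) q" and p: "truthful (set_pmf V) q p"
  shows "measure_pmf.expectation V (\<lambda>t. if norm1 t < b / 2 \<and> fav t = j
      then p t - (\<Sum>k\<in>UNIV - {j}. q t k * t k) else 0) \<le> r j" (is "measure_pmf.expectation V ?F \<le> _")
proof -
  have "measure_pmf.expectation V ?F =
      measure_pmf.expectation V (\<lambda>s. measure_pmf.expectation (W j) (\<lambda>x. ?F (s(j := x))))"
    unfolding V_def by (rule expectation_Pi_pmf_resample[OF fin])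
  also have "\<dots> \<le> r j"
  proof (rule measure_pmf.integral_le_const)
    show "AE s in measure_pmf V. measure_pmf.expectation (W j) (\<lambda>x. ?F (s(j := x))) \<le> r j"
    proof (clarsimp simp only: AE_measure_pmf_iff)
      fix s assume s: "s \<in> set_pmf V"
      define A where "A = {x \<in> set_pmf (W j). norm1 (s(j := x)) < b / 2 \<and> fav (s(j := x)) = j}"
      define p' where "p' x = p (s(j := x)) - (\<Sum>k\<in>UNIV - {j}. q (s(j := x)) k * s k)" for x
      define q' where "q' x = q (s(j := x)) j" for x
      have T: "s(j := x) \<in> set_pmf V" if "x \<in> A" for x
        using s that by (auto simp: set_pmf_V A_def)
      have nn: "0 \<le> x" if "x \<in> A" for x using that nonneg[of j] by (auto simp: A_def)
      have U: "utility q p (s(j := x)) (s(j := y)) = q' y * x - p' y" for x y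
      proof -
        have "(\<Sum>k\<in>UNIV. q (s(j := y)) k * (s(j := x)) k)
            = q' y * x + (\<Sum>k\<in>UNIV - {j}. q (s(j := y)) k * (s(j := x)) k)"
          by (subst sum.remove[of _ j]) (auto simp: q'_def)
        also have "(\<Sum>k\<in>UNIV - {j}. q (s(j := y)) k * (s(j := x)) k)
            = (\<Sum>k\<in>UNIV - {j}. q (s(j := y)) k * s k)"
          by (intro sum.cong) auto
        finally show ?thesis by (simp add: utility_def p'_def del: fun_upd_apply)
      qed
      have "measure_pmf.expectation (W j) (\<lambda>x. ?F (s(j := x)))
          = measure_pmf.expectation (W j) (\<lambda>x. if x \<in> A then p' x else 0)"
      proof (rule integral_cong_AE, simp, simp, unfold AE_measure_pmf_iff, rule ballI)
        fix x assume "x \<in> set_pmf (W j)"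
        have "(\<Sum>k\<in>UNIV - {j}. q (s(j := x)) k * (if k = j then x else s k))
            = (\<Sum>k\<in>UNIV - {j}. q (s(j := x)) k * s k)"
          by (intro sum.cong) auto
        with \<open>x \<in> set_pmf (W j)\<close> show "?F (s(j := x)) = (if x \<in> A then p' x else 0)"
          by (auto simp: A_def p'_def)
      qed
      also have "\<dots> \<le> r j * 1"
      proof (rule single_item_revenue[where q = q'])
        show "q' y * x - p' y \<le> q' x * x - p' x" if "x \<in> A" "y \<in> A" for x y
          using p T[OF that(1)] T[OF that(2)] unfolding truthful_def U[symmetric] by blast
        show "p' x \<le> q' x * x" if "x \<in> A" for x
          using p T[OF that] U[of x x] unfolding truthful_def by fastforce
        show "0 \<le> q' x \<and> q' x \<le> 1" if "x \<in> A" for x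
          using q T[OF that] by (simp add: mechanism_def q'_def)
        show "t * measure_pmf.prob (W j) {t..} \<le> r j" if "t \<in> A" for t
        proof -
          have "t \<le> b / 2" using le_norm1[of "s(j := t)" j] that by (simp add: A_def)
          then show ?thesis using P_opt[of t j] nn[OF that] by (simp add: r_def)
        qed
      qed (use fin r_nonneg nn in \<open>auto simp: A_def\<close>)
      finally show "measure_pmf.expectation (W j) (\<lambda>x. ?F (s(j := x))) \<le> r j" by simp
    qed
  qed simp
  finally show ?thesis .
qed

lemma mechanism_bound:
  assumes \<rho>: "\<rho> \<le> b / 2"
    and q: "mechanism (set_pmf V) q" and p: "truthful (set_pmf V) q p"
    and pb: "\<And>t. t \<in> set_pmf V \<Longrightarrow> p t \<le> b"
  shows "exp_payment V p \<le> 3 * BRev b V + \<rho> + (\<Sum>k\<in>UNIV. measure_pmf.expectation (W k) core)"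
proof -
  have "\<exists>j. \<forall>k. t k \<le> t j" for t :: "'m \<Rightarrow> real"
    using Max_in[of "range t"] Max_ge[of "range t"] by (metis finite finite_imageI image_iff rangeI UNIV_not_empty image_is_empty)
  then obtain fav where fav: "t k \<le> t (fav t)" for t :: "'m \<Rightarrow> real" and k
    by metis
  define F where "F j t = (if norm1 t < b / 2 \<and> fav t = j
      then p t - (\<Sum>k\<in>UNIV - {j}. q t k * t k) else 0)" for j t
  let ?I = "indicator {v :: 'm \<Rightarrow> real. b / 2 \<le> norm1 v} :: _ \<Rightarrow> real"
  have "exp_payment V p \<le> measure_pmf.expectation V (\<lambda>t. b * ?I t +
      (\<Sum>j\<in>UNIV. F j t) + (\<Sum>k\<in>UNIV. tail k t) + (\<Sum>k\<in>UNIV. core (t k)))"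
    unfolding exp_payment_V
  proof (rule expectation_mono)
    fix t assume t: "t \<in> set_pmf V"
    have nn: "0 \<le> tail k t" "0 \<le> core (t k)" for k
      using V_nonneg[OF t] by (auto simp: tail_def core_def)
    show "p t \<le> b * ?I t + (\<Sum>j\<in>UNIV. F j t) + (\<Sum>k\<in>UNIV. tail k t) + (\<Sum>k\<in>UNIV. core (t k))"
    proof (cases "norm1 t < b / 2")
      case False
      have "0 \<le> (\<Sum>k\<in>UNIV. tail k t)" "0 \<le> (\<Sum>k\<in>UNIV. core (t k))"
        using nn by (auto intro: sum_nonneg)
      with False show ?thesis using pb[OF t] by (simp add: F_def)
    next
      case True
      let ?j = "fav t"
      have "(\<Sum>j\<in>UNIV. F j t) = p t - (\<Sum>k\<in>UNIV - {?j}. q t k * t k)"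
        using True by (simp add: F_def)
      moreover have "(\<Sum>k\<in>UNIV - {?j}. q t k * t k) \<le> (\<Sum>k\<in>UNIV - {?j}. tail k t + core (t k))"
      proof (rule sum_mono)
        fix k assume k: "k \<in> UNIV - {?j}"
        have "q t k * t k \<le> t k"
          using q t V_nonneg[OF t] by (intro mult_left_le_one_le) (auto simp: mechanism_def)
        also have "t k \<le> tail k t + core (t k)"
          using le_norm1[of t k] True k fav[of t k] by (auto simp: tail_def core_def)
        finally show "q t k * t k \<le> tail k t + core (t k)" .
      qed
      moreover have "\<dots> \<le> (\<Sum>k\<in>UNIV. tail k t + core (t k))"
        using nn by (intro sum_mono2) (auto intro: add_nonneg_nonneg)
      ultimately show ?thesis using True by (simp add: sum.distrib)
    qed
  qed
  also have "\<dots> = b * measure_pmf.prob V {v. b / 2 \<le> norm1 v} +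
      (\<Sum>j\<in>UNIV. measure_pmf.expectation V (F j)) +
      (\<Sum>k\<in>UNIV. measure_pmf.expectation V (tail k)) +
      (\<Sum>k\<in>UNIV. measure_pmf.expectation (W k) core)"
    by (simp add: Bochner_Integration.integral_sum Bochner_Integration.integral_add)
      (simp add: V_def expectation_Pi_pmf_component[OF fin, where h = core])
  also have "b * measure_pmf.prob V {v. b / 2 \<le> norm1 v} \<le> 2 * BRev b V"
    using BRev_ge[of "b / 2"] b_pos by simp
  also have "(\<Sum>j\<in>UNIV. measure_pmf.expectation V (F j)) \<le> \<rho>"
    unfolding \<rho>_def F_def by (intro sum_mono single_bound q p)
  also have "(\<Sum>k\<in>UNIV. measure_pmf.expectation V (tail k)) \<le> BRev b V"
    by (rule tail_bound[OF \<rho>])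
  finally show ?thesis by simp
qed

lemma Rev_le: "Rev b V \<le> 5 * SRev b V + 6 * BRev b V"
  unfolding Rev_def
proof (rule cSup_least)
  show "rev_set b V \<noteq> {}" by (rule rev_set_bdd(1)[OF b_pos fin_V])
  fix x assume x: "x \<in> rev_set b V"
  have xb: "x \<le> b" by (rule rev_set_bdd(2)[OF b_pos fin_V x])
  obtain q p where qp: "x = exp_payment V p" "mechanism (set_pmf V) q" "truthful (set_pmf V) q p"
    "\<And>t. t \<in> set_pmf V \<Longrightarrow> p t \<le> b"
    using x by (auto simp: rev_set_def)
  show "x \<le> 5 * SRev b V + 6 * BRev b V"
  proof (cases "\<rho> \<le> b / 2")
    case True
    show ?thesis
      using mechanism_bound[OF True qp(2-4)] core_bound[OF True] SRev_ge_\<rho>[OF True] xb qp(1)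
        BRev_nonneg \<rho>_nonneg unfolding min_def by (auto split: if_splits)
  next
    case False
    then show ?thesis using SRev_ge_b xb BRev_nonneg b_pos by simp
  qed
qed

end

theorem theorem1:
  fixes b :: real
    and W :: "'m::finite \<Rightarrow> real pmf"
    and V :: "('m \<Rightarrow> real) pmf"
  assumes "b > 0"
    and "\<And>j. finite (set_pmf (W j))"
    and "\<And>j. set_pmf (W j) \<subseteq> {0..}"
    and "V = Pi_pmf UNIV 0 W"
  shows "Rev b V \<le> 5 * SRev b V + 6 * BRev b V"
proof -
  have "\<forall>j. \<exists>P. 0 \<le> P \<and> P \<le> b / 2 \<and> (\<forall>x. 0 \<le> x \<longrightarrow> x \<le> b / 2 \<longrightarrow>
      x * measure_pmf.prob (W j) {x..} \<le> P * measure_pmf.prob (W j) {P..})"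
    using assms(1,2) by (intro allI optimal_price_exists) auto
  then obtain P where P: "\<forall>j. 0 \<le> P j \<and> P j \<le> b / 2 \<and> (\<forall>x. 0 \<le> x \<longrightarrow> x \<le> b / 2 \<longrightarrow>
      x * measure_pmf.prob (W j) {x..} \<le> P j * measure_pmf.prob (W j) {P j..})"
    by metis
  interpret budgeted_product b W P
    by unfold_locales (use assms P in auto)
  show ?thesis
    using Rev_le by (simp add: assms(4) V_def)
qed

end
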